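(* For any positive odd integer $m$, the diagonal binary $\mathbb Z$-lattice $\ell=\langle 1,m\rangle$ is not recoverable.
   Context: A $\mathbb Z$-lattice is a free $\mathbb Z$-module $L$ of finite rank with a positive definite symmetric bilinear form $B:L\times L\to\mathbb Z$ (integral valued). $\langle a_1,\dots,a_k\rangle$ denotes the $\mathbb Z$-lattice with an orthogonal basis $x_1,\dots,x_k$ satisfying $B(x_i,x_i)=a_i$. A $\mathbb Z$-lattice $\ell$ is represented by $L$ if there is a $\mathbb Z$-linear map $\sigma:\ell\to L$ with $B(\sigma x,\sigma y)=B(x,y)$ for all $x,y\in\ell$. A $\mathbb Z$-lattice $\ell$ is recoverable if there is a finite set $\{\ell_1,\dots,\ell_t\}$ of proper sublattices of $\ell$ such that every $\mathbb Z$-lattice (of any rank) that represents all of $\ell_1,\dots,\ell_t$ also represents $\ell$. *)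

theory Defs
  imports Complex_Main "HOL-Library.Poly_Mapping"
begin


text \<open>The unique \<open>\<int>\<close>-module structure of an abelian group: \<open>zscale k x\<close> is \<open>k\<close> times \<open>x\<close>.\<close>

definition zscale :: "int \<Rightarrow> 'a::ab_group_add \<Rightarrow> 'a" where
  "zscale k x = ((\<lambda>y. y + x) ^^ nat k) 0 - ((\<lambda>y. y + x) ^^ nat (- k)) 0"

lemma zscale_0 [simp]: "zscale 0 x = 0"
  by (simp add: zscale_def)

lemma zscale_succ: "zscale (k + 1) x = zscale k x + x"
proof (cases "k \<ge> 0")
  case True
  then have "nat (k + 1) = Suc (nat k)" "nat (- k) = 0" "nat (- (k + 1)) = 0" by auto
  then show ?thesis by (simp add: zscale_def)
next
  case False
  then have "nat (- k) = Suc (nat (- (k + 1)))" "nat k = 0" "nat (k + 1) = 0" by auto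
  then show ?thesis by (simp add: zscale_def)
qed

lemma zscale_pred: "zscale (k - 1) x = zscale k x - x"
  using zscale_succ[of "k - 1" x] by simp

interpretation zmod: module "zscale :: int \<Rightarrow> 'a::ab_group_add \<Rightarrow> 'a"
proof
  fix a b :: int and x y :: 'a
  show "zscale a (x + y) = zscale a x + zscale a y"
    by (induction a rule: int_induct[where k = 0])
      (simp_all add: zscale_succ zscale_pred algebra_simps)
  show add: "zscale (c + b) x = zscale c x + zscale b x" for b c
  proof (induction b rule: int_induct[where k = 0])
    case (step1 i)
    then show ?case using zscale_succ[of "c + i" x] zscale_succ[of i x] by (simp add: add.assoc)
  next
    case (step2 i)
    then show ?case using zscale_pred[of "c + i" x] zscale_pred[of i x] by (simp add: add_diff_eq)
  qed simp
  have diff: "zscale (c - b) x = zscale c x - zscale b x" for c b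
    using add[of "c - b" b] by simp
  show "zscale a (zscale b x) = zscale (a * b) x"
    by (induction a rule: int_induct[where k = 0])
      (simp_all add: zscale_succ zscale_pred ring_distribs add diff)
  show "zscale 1 x = x"
    using zscale_succ[of 0 x] by simp
qed



text \<open>Only the values of \<open>form\<close> on \<open>carr\<close> are relevant.\<close>

record 'a zlat =
  carr :: "'a set"
  form :: "'a \<Rightarrow> 'a \<Rightarrow> int"

definition zbasis :: "'a::ab_group_add set \<Rightarrow> 'a set \<Rightarrow> bool" where
  "zbasis b M \<longleftrightarrow> zmod.independent b \<and> zmod.span b = M"

definition Z_lattice :: "'a::ab_group_add zlat \<Rightarrow> bool" where
  "Z_lattice L \<longleftrightarrow>
     (\<exists>b. finite b \<and> zbasis b (carr L)) \<and>
     (\<forall>x\<in>carr L. \<forall>y\<in>carr L. form L x y = form L y x) \<and>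
     (\<forall>x\<in>carr L. \<forall>y\<in>carr L. \<forall>z\<in>carr L. form L (x + y) z = form L x z + form L y z) \<and>
     (\<forall>k. \<forall>x\<in>carr L. \<forall>z\<in>carr L. form L (zscale k x) z = k * form L x z) \<and>
     (\<forall>x\<in>carr L. x \<noteq> 0 \<longrightarrow> form L x x > 0)"

definition represents :: "'a::ab_group_add zlat \<Rightarrow> 'b::ab_group_add zlat \<Rightarrow> bool" where
  "represents L l \<longleftrightarrow>
     (\<exists>\<sigma>. (\<forall>x\<in>carr l. \<sigma> x \<in> carr L) \<and>
          (\<forall>x\<in>carr l. \<forall>y\<in>carr l. \<sigma> (x + y) = \<sigma> x + \<sigma> y) \<and>
          (\<forall>k. \<forall>x\<in>carr l. \<sigma> (zscale k x) = zscale k (\<sigma> x)) \<and>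
          (\<forall>x\<in>carr l. \<forall>y\<in>carr l. form L (\<sigma> x) (\<sigma> y) = form l x y))"

definition sublattice :: "'a::ab_group_add zlat \<Rightarrow> 'a zlat \<Rightarrow> bool" where
  "sublattice M L \<longleftrightarrow>
     Z_lattice M \<and> carr M \<subseteq> carr L \<and>
     (\<forall>x\<in>carr M. \<forall>y\<in>carr M. form M x y = form L x y)"

definition proper_sublattice :: "'a::ab_group_add zlat \<Rightarrow> 'a zlat \<Rightarrow> bool" where
  "proper_sublattice M L \<longleftrightarrow> sublattice M L \<and> carr M \<noteq> carr L"

text \<open>
  A definition in HOL cannot quantify over types, so the lattices \<open>L\<close> below live in one fixed
  abelian group, the free abelian group \<open>nat \<Rightarrow>\<^sub>0 int\<close> of countable rank.  Every \<open>\<int>\<close>-lattice on any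
  type is isometric to one of these, of the same rank; lemma \<open>recoverable_universe\<close> shows that
  nothing is lost.
\<close>

definition recoverable :: "'a::ab_group_add zlat \<Rightarrow> bool" where
  "recoverable l \<longleftrightarrow>
     (\<exists>S. finite S \<and> (\<forall>M\<in>S. proper_sublattice M l) \<and>
        (\<forall>L :: (nat \<Rightarrow>\<^sub>0 int) zlat.
           Z_lattice L \<and> (\<forall>M\<in>S. represents L M) \<longrightarrow> represents L l))"

text \<open>
  The lattice \<open>\<langle>a\<^sub>0, \<dots>, a\<^sub>k\<^sub>-\<^sub>1\<rangle>\<close> on \<open>\<int>\<^sup>k\<close>; the orthogonal basis consists of the unit vectors
  \<open>frag_of i\<close>, \<open>i < k\<close> (see \<open>diag_zlat_orthogonal_basis\<close>).
\<close>

definition diag_zlat :: "int list \<Rightarrow> (nat \<Rightarrow>\<^sub>0 int) zlat" where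
  "diag_zlat a =
     \<lparr>carr = {x. Poly_Mapping.keys x \<subseteq> {..<length a}},
      form = (\<lambda>x y. \<Sum>i<length a. a ! i * Poly_Mapping.lookup x i * Poly_Mapping.lookup y i)\<rparr>"



lemma lookup_zscale [simp]:
  "Poly_Mapping.lookup (zscale k x) i = k * Poly_Mapping.lookup x i"
  for x :: "'a \<Rightarrow>\<^sub>0 int"
  by (induction k rule: int_induct[where k = 0])
    (simp_all add: zscale_succ zscale_pred lookup_add lookup_minus algebra_simps)

lemma lookup_frag_comb:
  "finite A \<Longrightarrow> Poly_Mapping.lookup (\<Sum>i\<in>A. zscale (c i) (frag_of i)) j = (if j \<in> A then c j else 0)"
  by (induction A rule: finite_induct) (auto simp: lookup_add)

lemma inj_frag_of: "inj_on frag_of A"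
  by (simp add: inj_on_def frag_of_eq)

lemma zbasis_frag_of:
  "zbasis (frag_of ` {..<n}) {x :: nat \<Rightarrow>\<^sub>0 int. Poly_Mapping.keys x \<subseteq> {..<n}}"
  unfolding zbasis_def
proof (intro conjI equalityI subsetI)
  show "zmod.independent (frag_of ` {..<n})"
  proof
    assume "zmod.dependent (frag_of ` {..<n})"
    then obtain u v where v: "v \<in> frag_of ` {..<n}" "u v \<noteq> 0"
      and 0: "(\<Sum>v\<in>frag_of ` {..<n}. zscale (u v) v) = 0"
      by (auto simp: zmod.dependent_finite)
    from v obtain j where j: "j < n" "v = frag_of j" by auto
    have "(\<Sum>i<n. zscale (u (frag_of i)) (frag_of i)) = 0"
      using 0 by (simp add: sum.reindex[OF inj_frag_of])
    then have "u (frag_of j) = 0"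
      using lookup_frag_comb[of "{..<n}" "\<lambda>i. u (frag_of i)" j] j by simp
    with v j show False by simp
  qed
next
  fix x :: "nat \<Rightarrow>\<^sub>0 int" assume "x \<in> zmod.span (frag_of ` {..<n})"
  then show "x \<in> {x. Poly_Mapping.keys x \<subseteq> {..<n}}"
  proof (induction rule: zmod.span_induct_alt)
    case (step c x y)
    then show ?case
      by (auto simp: in_keys_iff lookup_add lookup_single split: if_splits)
  qed simp
next
  fix x :: "nat \<Rightarrow>\<^sub>0 int" assume "x \<in> {x. Poly_Mapping.keys x \<subseteq> {..<n}}"
  then have "x = (\<Sum>i<n. zscale (Poly_Mapping.lookup x i) (frag_of i))"
    by (intro poly_mapping_eqI) (auto simp: lookup_frag_comb in_keys_iff)
  also have "\<dots> \<in> zmod.span (frag_of ` {..<n})"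
    by (intro zmod.span_sum zmod.span_scale zmod.span_base) auto
  finally show "x \<in> zmod.span (frag_of ` {..<n})" .
qed

lemma diag_zlat_orthogonal_basis:
  "zbasis (frag_of ` {..<length a}) (carr (diag_zlat a))"
  "i < length a \<Longrightarrow> j < length a \<Longrightarrow>
     form (diag_zlat a) (frag_of i) (frag_of j) = (if i = j then a ! i else 0)"
proof -
  show "zbasis (frag_of ` {..<length a}) (carr (diag_zlat a))"
    using zbasis_frag_of by (simp add: diag_zlat_def)
  assume "i < length a" "j < length a"
  have "form (diag_zlat a) (frag_of i) (frag_of j) =
      (\<Sum>k<length a. if k = i then (if i = j then a ! i else 0) else 0)"
    unfolding diag_zlat_def zlat.simps by (rule sum.cong) auto
  with \<open>i < length a\<close> show
    "form (diag_zlat a) (frag_of i) (frag_of j) = (if i = j then a ! i else 0)" by simp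
qed

lemma Z_lattice_diag_zlat:
  assumes "\<forall>c\<in>set a. c > 0"
  shows "Z_lattice (diag_zlat a)"
  unfolding Z_lattice_def
proof (intro conjI ballI allI impI)
  show "\<exists>b. finite b \<and> zbasis b (carr (diag_zlat a))"
    using diag_zlat_orthogonal_basis(1) by blast
next
  fix x y assume "x \<in> carr (diag_zlat a)" "y \<in> carr (diag_zlat a)"
  show "form (diag_zlat a) x y = form (diag_zlat a) y x"
    by (simp add: diag_zlat_def mult_ac)
next
  fix x y z
  show "form (diag_zlat a) (x + y) z = form (diag_zlat a) x z + form (diag_zlat a) y z"
    by (simp add: diag_zlat_def lookup_add algebra_simps sum.distrib)
next
  fix k x z
  show "form (diag_zlat a) (zscale k x) z = k * form (diag_zlat a) x z"
    by (simp add: diag_zlat_def sum_distrib_left mult_ac)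
next
  fix x assume x: "x \<in> carr (diag_zlat a)" "x \<noteq> 0"
  then obtain i where i: "i \<in> Poly_Mapping.keys x" by fastforce
  with x have "i < length a" by (auto simp: diag_zlat_def)
  have pos: "a ! k > 0" if "k < length a" for k
    using assms that by simp
  show "form (diag_zlat a) x x > 0"
    unfolding diag_zlat_def zlat.simps
  proof (rule sum_pos2[where i = i])
    show "0 < a ! i * Poly_Mapping.lookup x i * Poly_Mapping.lookup x i"
      using i pos[OF \<open>i < length a\<close>] by (simp add: in_keys_iff mult.assoc zero_less_mult_iff) arith
    show "0 \<le> a ! k * Poly_Mapping.lookup x k * Poly_Mapping.lookup x k" if "k \<in> {..<length a}" for k
      using pos[of k] that by (simp add: mult.assoc)
  qed (use \<open>i < length a\<close> in auto)
qed

lemma represents_trans: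
  assumes "represents K L" "represents L M"
  shows "represents K M"
proof -
  obtain s where "(\<forall>x\<in>carr L. s x \<in> carr K) \<and>
          (\<forall>x\<in>carr L. \<forall>y\<in>carr L. s (x + y) = s x + s y) \<and>
          (\<forall>k. \<forall>x\<in>carr L. s (zscale k x) = zscale k (s x)) \<and>
          (\<forall>x\<in>carr L. \<forall>y\<in>carr L. form K (s x) (s y) = form L x y)"
    using assms(1) unfolding represents_def by blast
  moreover obtain t where "(\<forall>x\<in>carr M. t x \<in> carr L) \<and>
          (\<forall>x\<in>carr M. \<forall>y\<in>carr M. t (x + y) = t x + t y) \<and>
          (\<forall>k. \<forall>x\<in>carr M. t (zscale k x) = zscale k (t x)) \<and>
          (\<forall>x\<in>carr M. \<forall>y\<in>carr M. form L (t x) (t y) = form M x y)"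
    using assms(2) unfolding represents_def by blast
  ultimately show ?thesis
    unfolding represents_def by (intro exI[of _ "s \<circ> t"]) simp
qed

lemma Z_lattice_coordinates:
  fixes L :: "'a::ab_group_add zlat"
  assumes "Z_lattice L"
  obtains L' :: "(nat \<Rightarrow>\<^sub>0 int) zlat"
  where "Z_lattice L'" "represents L L'" "represents L' L"
proof -
  from assms obtain b where b: "finite b" "zmod.independent b" "zmod.span b = carr L"
    by (auto simp: Z_lattice_def zbasis_def)
  define n where "n = card b"
  obtain f where f: "bij_betw f {..<n} b"
    using ex_bij_betw_nat_finite[OF b(1)] by (auto simp: n_def atLeast0LessThan)
  define C where "C = {x :: nat \<Rightarrow>\<^sub>0 int. Poly_Mapping.keys x \<subseteq> {..<n}}"
  define g where "g x = (\<Sum>i<n. zscale (Poly_Mapping.lookup x i) (f i))" for x :: "nat \<Rightarrow>\<^sub>0 int"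
  have C: "zmod.subspace C"
    using zbasis_frag_of[of n] zmod.subspace_span[of "frag_of ` {..<n}"]
    by (simp add: zbasis_def C_def)
  have sub: "zmod.subspace (carr L)"
    using b(3) zmod.subspace_span by metis
  have add: "g (x + y) = g x + g y" for x y
    by (simp add: g_def lookup_add zmod.scale_left_distrib sum.distrib)
  have scale: "g (zscale k x) = zscale k (g x)" for k x
    by (simp add: g_def zmod.scale_sum_right)
  have inC: "g x \<in> carr L" for x
    unfolding g_def b(3)[symmetric]
    using f by (intro zmod.span_sum zmod.span_scale zmod.span_base) (auto simp: bij_betw_def)
  have inj0: "x = 0" if "x \<in> C" "g x = 0" for x
  proof (rule poly_mapping_eqI)
    fix i
    have "(\<Sum>v\<in>b. zscale (Poly_Mapping.lookup x (inv_into {..<n} f v)) v) = g x"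
      unfolding g_def using f
      by (intro sum.reindex_bij_betw[OF f, symmetric, THEN trans] sum.cong)
        (auto simp: bij_betw_def)
    then have "Poly_Mapping.lookup x (inv_into {..<n} f v) = 0" if "v \<in> b" for v
      using zmod.independentD[OF b(2) b(1) order_refl, of "\<lambda>v. Poly_Mapping.lookup x (inv_into {..<n} f v)" v]
        that \<open>g x = 0\<close> by simp
    then have "Poly_Mapping.lookup x i = 0" if "i < n"
      using that f by (metis bij_betw_def bij_betw_apply inv_into_f_f lessThan_iff)
    then show "Poly_Mapping.lookup x i = Poly_Mapping.lookup 0 i"
      using \<open>x \<in> C\<close> by (cases "i < n") (auto simp: C_def in_keys_iff)
  qed
  have surj: "y \<in> g ` C" if "y \<in> carr L" for y
  proof -
    from that b have "y \<in> range (\<lambda>u. \<Sum>v\<in>b. zscale (u v) v)"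
      by (simp add: zmod.span_finite)
    then obtain u where "y = (\<Sum>v\<in>b. zscale (u v) v)" by auto
    also have "\<dots> = (\<Sum>i<n. zscale (u (f i)) (f i))"
      using sum.reindex_bij_betw[OF f, of "\<lambda>v. zscale (u v) v"] by simp
    also have "\<dots> = g (\<Sum>i<n. zscale (u (f i)) (frag_of i))"
      unfolding g_def by (intro sum.cong) (simp_all add: lookup_frag_comb)
    finally show ?thesis
      by (auto simp: C_def in_keys_iff lookup_frag_comb split: if_splits intro!: imageI)
  qed
  have inj: "inj_on g C"
  proof (rule inj_onI)
    fix x y assume xy: "x \<in> C" "y \<in> C" "g x = g y"
    then have "g (x - y) = 0" using add[of "x - y" y] by simp
    with xy C show "x = y" using inj0[of "x - y"] by (simp add: zmod.subspace_diff)
  qed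
  define L' where "L' = \<lparr>carr = C, form = (\<lambda>x y. form L (g x) (g y))\<rparr>"
  have [simp]: "carr L' = C" "form L' x y = form L (g x) (g y)" for x y
    by (simp_all add: L'_def)
  have "Z_lattice L'"
    unfolding Z_lattice_def
  proof (intro conjI ballI allI impI)
    show "\<exists>b. finite b \<and> zbasis b (carr L')"
      using zbasis_frag_of[of n] by (auto simp: C_def intro!: exI[of _ "frag_of ` {..<n}"])
  qed (use assms inC in \<open>auto simp: Z_lattice_def add scale dest: inj0\<close>)
  moreover have "represents L L'"
    unfolding represents_def by (intro exI[of _ g]) (simp add: inC add scale)
  moreover have "represents L' L"
    unfolding represents_def
  proof (intro exI[of _ "inv_into C g"] conjI ballI allI)
    have g_inv: "g (inv_into C g y) = y" "inv_into C g y \<in> C" if "y \<in> carr L" for y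
      using surj[OF that] by (simp_all add: f_inv_into_f inv_into_into)
    note in_C = g_inv zmod.subspace_add[OF C] zmod.subspace_scale[OF C]
      zmod.subspace_add[OF sub] zmod.subspace_scale[OF sub]
    fix x y k assume x: "x \<in> carr L"
    show "inv_into C g x \<in> carr L'" using x g_inv by simp
    show "inv_into C g (zscale k x) = zscale k (inv_into C g x)"
      using x by (intro inj_onD[OF inj]) (simp_all add: in_C scale)
    assume y: "y \<in> carr L"
    show "inv_into C g (x + y) = inv_into C g x + inv_into C g y"
      using x y by (intro inj_onD[OF inj]) (simp_all add: in_C add)
    show "form L' (inv_into C g x) (inv_into C g y) = form L x y"
      using x y g_inv by simp
  qed
  ultimately show thesis by (rule that)
qed

lemma recoverable_universe:
  fixes l :: "'a::ab_group_add zlat" and L :: "'b::ab_group_add zlat"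
  assumes "\<forall>L :: (nat \<Rightarrow>\<^sub>0 int) zlat. Z_lattice L \<and> (\<forall>M\<in>S. represents L M) \<longrightarrow> represents L l"
    and "Z_lattice L" "\<forall>M\<in>S. represents L M"
  shows "represents L l"
  using Z_lattice_coordinates[OF assms(2)] assms(1,3) by (metis represents_trans)

end

theory Submission
  imports Defs "HOL-Library.Product_Plus" "HOL-Computational_Algebra.Primes"
begin

text \<open>
  Call a lattice \<open>K\<close> even up to \<open>m\<close> if all its norms that are at most \<open>m\<close> are even.  For odd \<open>m\<close>,
  the lattice \<open>\<langle>1\<rangle> \<bottom> K\<close> then has only two vectors of norm \<open>1\<close>, and their orthogonal complement \<open>K\<close>
  does not represent \<open>m\<close>; so \<open>\<langle>1\<rangle> \<bottom> K\<close> does not represent \<open>\<langle>1, m\<rangle>\<close>.  As the property is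
  preserved by orthogonal sums, it suffices to find, for a single proper sublattice \<open>M\<close> of
  \<open>\<langle>1, m\<rangle>\<close>, a suitable \<open>K\<close> such that \<open>\<langle>1\<rangle> \<bottom> K\<close> represents \<open>M\<close>.

  Some prime \<open>p\<close> satisfies \<open>p | y\<close> or \<open>p | x - s y\<close> for all \<open>(x, y) \<in> M\<close>.  If \<open>p | y\<close>, take
  \<open>K = \<langle>p\<^sup>2 m\<rangle>\<close>.  Otherwise, apart from the symmetric case \<open>m = 1\<close>, \<open>p | x\<close>, there is a
  linear form \<open>a\<close> on \<open>M\<close>, namely \<open>a = (x + \<beta> y) / p\<close> with \<open>\<beta>\<close> odd if \<open>p\<close> is odd, and \<open>a = 0\<close> or
  \<open>a = y\<close> if \<open>p = 2\<close>, with \<open>a\<^sup>2 < x\<^sup>2 + m y\<^sup>2\<close> away from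
  \<open>0\<close> and \<open>a \<equiv> x + y\<close> modulo \<open>2\<close>; take for \<open>K\<close> the module \<open>M\<close> with the even form
  \<open>x\<^sup>2 + m y\<^sup>2 - a\<^sup>2\<close>.
\<close>

section \<open>Products of Z-modules and orthogonal sums of lattices\<close>

lemma zscale_Pair: "zscale k (x, y) = (zscale k x, zscale k y)"
  by (induction k rule: int_induct[where k = 0])
    (simp_all add: zscale_succ zscale_pred zero_prod_def)

lemma fst_zscale [simp]: "fst (zscale k x) = zscale k (fst x)"
  and snd_zscale [simp]: "snd (zscale k x) = zscale k (snd x)"
  by (cases x; simp add: zscale_Pair)+

lemma zbasis_Times:
  fixes A :: "'a::ab_group_add set" and B :: "'b::ab_group_add set"
  assumes "finite A" "finite B" "zbasis A M" "zbasis B N"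
  shows "zbasis ((\<lambda>x. (x, 0)) ` A \<union> (\<lambda>y. (0, y)) ` B) (M \<times> N)"
    (is "zbasis (?A \<union> ?B) _")
proof -
  have ind: "zmod.independent A" "zmod.independent B"
    and span: "zmod.span A = M" "zmod.span B = N"
    using assms by (auto simp: zbasis_def)
  have fin: "finite (?A \<union> ?B)" using assms by simp
  have inj: "inj_on (\<lambda>x. (x, 0::'b)) A" "inj_on (\<lambda>y. (0::'a, y)) B"
    by (auto simp: inj_on_def)
  have disj: "?A \<inter> ?B = {}"
    using ind zmod.dependent_zero by auto
  have sum: "(\<Sum>v\<in>?A \<union> ?B. zscale (u v) v) =
      (\<Sum>x\<in>A. zscale (u (x, 0)) x, \<Sum>y\<in>B. zscale (u (0, y)) y)" for u
    using assms disj
    by (subst sum.union_disjoint)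
      (auto simp: sum.reindex inj prod_eq_iff fst_sum snd_sum)
  show ?thesis
    unfolding zbasis_def
  proof (intro conjI set_eqI)
    show "zmod.independent (?A \<union> ?B)"
    proof
      assume "zmod.dependent (?A \<union> ?B)"
      then obtain u v where v: "v \<in> ?A \<union> ?B" "u v \<noteq> 0"
        and 0: "(\<Sum>v\<in>?A \<union> ?B. zscale (u v) v) = 0"
        unfolding zmod.dependent_finite[OF fin] by blast
      from 0 have "(\<Sum>x\<in>A. zscale (u (x, 0)) x) = 0" "(\<Sum>y\<in>B. zscale (u (0, y)) y) = 0"
        unfolding sum by (simp_all add: zero_prod_def)
      then have "\<forall>x\<in>A. u (x, 0) = 0" "\<forall>y\<in>B. u (0, y) = 0"
        using zmod.independentD[OF ind(1) assms(1) order_refl, of "\<lambda>x. u (x, 0)"]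
          zmod.independentD[OF ind(2) assms(2) order_refl, of "\<lambda>y. u (0, y)"] by auto
      with v show False by auto
    qed
  next
    fix z :: "'a \<times> 'b"
    show "z \<in> zmod.span (?A \<union> ?B) \<longleftrightarrow> z \<in> M \<times> N"
    proof
      assume "z \<in> zmod.span (?A \<union> ?B)"
      then obtain u where u: "z = (\<Sum>v\<in>?A \<union> ?B. zscale (u v) v)"
        using fin by (auto simp: zmod.span_finite)
      show "z \<in> M \<times> N"
        unfolding u sum span[symmetric]
        by (intro SigmaI zmod.span_sum zmod.span_scale zmod.span_base)
    next
      assume "z \<in> M \<times> N"
      then obtain f g where "z = (\<Sum>x\<in>A. zscale (f x) x, \<Sum>y\<in>B. zscale (g y) y)"
        using span assms by (cases z) (auto simp: zmod.span_finite)
      also have "\<dots> = (\<Sum>x\<in>A. zscale (f x) (x, 0)) + (\<Sum>y\<in>B. zscale (g y) (0, y))"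
        by (simp add: prod_eq_iff fst_sum snd_sum)
      also have "\<dots> \<in> zmod.span (?A \<union> ?B)"
        by (intro zmod.span_add zmod.span_sum zmod.span_scale zmod.span_base) auto
      finally show "z \<in> zmod.span (?A \<union> ?B)" .
    qed
  qed
qed

definition osum :: "'a::ab_group_add zlat \<Rightarrow> 'b::ab_group_add zlat \<Rightarrow> ('a \<times> 'b) zlat" where
  "osum L K = \<lparr>carr = carr L \<times> carr K,
     form = (\<lambda>x y. form L (fst x) (fst y) + form K (snd x) (snd y))\<rparr>"

lemma osum_simps [simp]:
  "carr (osum L K) = carr L \<times> carr K"
  "form (osum L K) x y = form L (fst x) (fst y) + form K (snd x) (snd y)"
  by (simp_all add: osum_def)

lemma Z_lattice_subspace: "Z_lattice L \<Longrightarrow> zmod.subspace (carr L)"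
  unfolding Z_lattice_def zbasis_def using zmod.subspace_span by metis

lemma Z_lattice_form_zero:
  assumes "Z_lattice L" "x \<in> carr L"
  shows "form L 0 x = 0"
proof -
  have "form L (zscale 0 0) x = 0 * form L 0 x"
    using assms zmod.subspace_0[OF Z_lattice_subspace[OF assms(1)]]
    unfolding Z_lattice_def by blast
  then show ?thesis by simp
qed

lemma Z_lattice_form_nonneg:
  assumes "Z_lattice L" "x \<in> carr L"
  shows "form L x x \<ge> 0"
proof (cases "x = 0")
  case False
  then have "form L x x > 0" using assms unfolding Z_lattice_def by blast
  then show ?thesis by simp
qed (use Z_lattice_form_zero[OF assms] in simp)

lemma Z_lattice_osum:
  assumes L: "Z_lattice L" and K: "Z_lattice K"
  shows "Z_lattice (osum L K)"
  unfolding Z_lattice_def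
proof (intro conjI ballI allI impI)
  from L obtain A where "finite A" "zbasis A (carr L)" by (auto simp: Z_lattice_def)
  moreover from K obtain B where "finite B" "zbasis B (carr K)" by (auto simp: Z_lattice_def)
  ultimately show "\<exists>b. finite b \<and> zbasis b (carr (osum L K))"
    using zbasis_Times[of A B "carr L" "carr K"]
    by (intro exI[of _ "(\<lambda>x. (x, 0)) ` A \<union> (\<lambda>y. (0, y)) ` B"]) simp
next
  fix x assume x: "x \<in> carr (osum L K)" "x \<noteq> 0"
  then have "fst x \<noteq> 0 \<or> snd x \<noteq> 0" by (auto simp: prod_eq_iff)
  moreover have "fst x \<in> carr L" "snd x \<in> carr K" using x by auto
  ultimately have "form L (fst x) (fst x) > 0 \<or> form K (snd x) (snd x) > 0"
    using L K unfolding Z_lattice_def by blast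
  moreover have "form L (fst x) (fst x) \<ge> 0" "form K (snd x) (snd x) \<ge> 0"
    using x L K by (auto intro: Z_lattice_form_nonneg)
  ultimately show "form (osum L K) x x > 0" by auto
qed (use L K in \<open>auto simp: Z_lattice_def zscale_Pair algebra_simps\<close>)

lemma represents_osum1:
  assumes "Z_lattice K"
  shows "represents (osum L K) L"
proof -
  have "0 \<in> carr K" using Z_lattice_subspace[OF assms] zmod.subspace_0 by blast
  then show ?thesis
    unfolding represents_def using Z_lattice_form_zero[OF assms]
    by (intro exI[of _ "\<lambda>x. (x, 0)"]) (simp add: zscale_Pair)
qed

lemma represents_osum2:
  assumes "Z_lattice L"
  shows "represents (osum L K) K"
proof -
  have "0 \<in> carr L" using Z_lattice_subspace[OF assms] zmod.subspace_0 by blast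
  then show ?thesis
    unfolding represents_def using Z_lattice_form_zero[OF assms]
    by (intro exI[of _ "\<lambda>x. (0, x)"]) (simp add: zscale_Pair)
qed

lemma represents_osum_mono:
  assumes "represents K K'"
  shows "represents (osum L K) (osum L K')"
proof -
  obtain s where "(\<forall>x\<in>carr K'. s x \<in> carr K) \<and>
          (\<forall>x\<in>carr K'. \<forall>y\<in>carr K'. s (x + y) = s x + s y) \<and>
          (\<forall>k. \<forall>x\<in>carr K'. s (zscale k x) = zscale k (s x)) \<and>
          (\<forall>x\<in>carr K'. \<forall>y\<in>carr K'. form K (s x) (s y) = form K' x y)"
    using assms unfolding represents_def by blast
  then show ?thesis
    unfolding represents_def
    by (intro exI[of _ "\<lambda>x. (fst x, s (snd x))"]) (auto simp: zscale_Pair)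
qed

section \<open>Lattices whose norms up to \<open>m\<close> are even\<close>

text \<open>The bound leaves room for \<open>diag_zlat [p\<^sup>2 * m]\<close> with an odd prime
  \<open>p\<close>, whose odd norms all exceed \<open>m\<close>.\<close>

definition even_upto :: "int \<Rightarrow> 'a zlat \<Rightarrow> bool" where
  "even_upto m K \<longleftrightarrow> (\<forall>v\<in>carr K. even (form K v v) \<or> form K v v > m)"

text \<open>An odd sum has an odd summand; it exceeds \<open>m\<close>, and the other summand is not
  negative.\<close>

lemma even_upto_osum:
  assumes "Z_lattice L" "even_upto m L" "Z_lattice K" "even_upto m K"
  shows "even_upto m (osum L K)"
proof -
  have "even (form L x x + form K y y) \<or> form L x x + form K y y > m"
    if "x \<in> carr L" "y \<in> carr K" for x y
    using assms that Z_lattice_form_nonneg[of L x] Z_lattice_form_nonneg[of K y]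
    unfolding even_upto_def by (smt (verit) even_add)
  then show ?thesis by (auto simp: even_upto_def)
qed

lemma even_upto_represents:
  assumes "represents L K" "even_upto m L"
  shows "even_upto m K"
  using assms unfolding represents_def even_upto_def by metis

text \<open>\<open>K\<close> is built as the orthogonal sum of the members of \<open>F\<close>. A
  sum lives on a product type, so each step returns to \<open>nat \<Rightarrow>\<^sub>0 int\<close>
  through \<open>Z_lattice_coordinates\<close>; representation in one direction transports
  \<open>even_upto\<close>, in the other it yields the summands.\<close>

lemma even_upto_common:
  fixes F :: "(nat \<Rightarrow>\<^sub>0 int) zlat set"
  assumes "finite F" "\<forall>K\<in>F. Z_lattice K \<and> even_upto m K"
  shows "\<exists>K :: (nat \<Rightarrow>\<^sub>0 int) zlat. Z_lattice K \<and> even_upto m K \<and> (\<forall>K'\<in>F. represents K K')"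
  using assms
proof (induction F rule: finite_induct)
  case empty
  have "Z_lattice (diag_zlat [])" by (simp add: Z_lattice_diag_zlat)
  moreover have "even_upto m (diag_zlat [])" by (simp add: even_upto_def diag_zlat_def)
  ultimately show ?case by blast
next
  case (insert J F)
  then obtain K :: "(nat \<Rightarrow>\<^sub>0 int) zlat"
    where K: "Z_lattice K" "even_upto m K" "\<forall>K'\<in>F. represents K K'"
    by auto
  have J: "Z_lattice J" "even_upto m J" using insert.prems by auto
  obtain L :: "(nat \<Rightarrow>\<^sub>0 int) zlat"
    where L: "Z_lattice L" "represents (osum J K) L" "represents L (osum J K)"
    using Z_lattice_coordinates[OF Z_lattice_osum[OF J(1) K(1)]] by metis
  have "even_upto m L"
    using even_upto_represents[OF L(2) even_upto_osum[OF J K(1,2)]] .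
  moreover have "represents L J"
    using represents_trans[OF L(3) represents_osum1[OF K(1)]] .
  moreover have "represents L K'" if "K' \<in> F" for K'
    using K(3) that represents_trans[OF L(3) represents_osum2[OF J(1)]] represents_trans by blast
  ultimately show ?case using L(1) by blast
qed

lemma form_diag_zlat_singleton:
  "form (diag_zlat [c]) x y = c * Poly_Mapping.lookup x 0 * Poly_Mapping.lookup y 0"
  by (simp add: diag_zlat_def)

lemma form_diag_zlat_pair:
  "form (diag_zlat [b, c]) x y =
     b * Poly_Mapping.lookup x 0 * Poly_Mapping.lookup y 0 +
     c * Poly_Mapping.lookup x 1 * Poly_Mapping.lookup y 1"
  by (simp add: diag_zlat_def lessThan_Suc numeral_2_eq_2)

lemma carr_diag_zlat_pair_eqI:
  assumes "x \<in> carr (diag_zlat [b, c])" "y \<in> carr (diag_zlat [b, c])"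
    and "Poly_Mapping.lookup x 0 = Poly_Mapping.lookup y 0"
    and "Poly_Mapping.lookup x 1 = Poly_Mapping.lookup y 1"
  shows "x = y"
proof (rule poly_mapping_eqI)
  fix i :: nat
  consider "i = 0" | "i = 1" | "i \<ge> 2" by linarith
  then show "Poly_Mapping.lookup x i = Poly_Mapping.lookup y i"
  proof cases
    case 3
    then have "i \<notin> Poly_Mapping.keys x" "i \<notin> Poly_Mapping.keys y"
      using assms(1,2) by (auto simp: diag_zlat_def)
    then show ?thesis by (simp add: in_keys_iff)
  qed (use assms in simp_all)
qed

lemma not_represents_even_upto:
  fixes K :: "'a::ab_group_add zlat"
  assumes "m > 0" "odd m" and K: "Z_lattice K" "even_upto m K"
  shows "\<not> represents (osum (diag_zlat [1]) K) (diag_zlat [1, m])"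
proof
  let ?l = "diag_zlat [1, m]"
  assume "represents (osum (diag_zlat [1]) K) ?l"
  then obtain \<sigma> where \<sigma>: "\<forall>x\<in>carr ?l. \<sigma> x \<in> carr (osum (diag_zlat [1]) K)"
    "\<forall>x\<in>carr ?l. \<forall>y\<in>carr ?l. form (osum (diag_zlat [1]) K) (\<sigma> x) (\<sigma> y) = form ?l x y"
    unfolding represents_def by blast
  have e: "frag_of 0 \<in> carr ?l" "frag_of 1 \<in> carr ?l"
    by (auto simp: diag_zlat_def)
  obtain u v where u: "\<sigma> (frag_of 0) = (u, v)" by fastforce
  obtain u' v' where u': "\<sigma> (frag_of 1) = (u', v')" by fastforce
  have v: "v \<in> carr K" "v' \<in> carr K" using \<sigma>(1) e u u' by fastforce+
  let ?s = "Poly_Mapping.lookup u 0" and ?t = "Poly_Mapping.lookup u' 0"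
  have 1: "?s * ?s + form K v v = 1"
    using \<sigma>(2)[rule_format, OF e(1) e(1)] u
    by (simp add: form_diag_zlat_singleton form_diag_zlat_pair lookup_one)
  have 2: "?s * ?t + form K v v' = 0"
    using \<sigma>(2)[rule_format, OF e(1) e(2)] u u'
    by (simp add: form_diag_zlat_singleton form_diag_zlat_pair lookup_one)
  have 3: "?t * ?t + form K v' v' = m"
    using \<sigma>(2)[rule_format, OF e(2) e(2)] u'
    by (simp add: form_diag_zlat_singleton form_diag_zlat_pair lookup_one)
  have "form K v v \<le> 1" using 1 zero_le_square[of ?s] by linarith
  moreover have "form K v v \<ge> 0" using Z_lattice_form_nonneg[OF K(1) v(1)] .
  moreover have "even (form K v v) \<or> form K v v > m" using K(2) v(1) by (simp add: even_upto_def)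
  \<comment> \<open>The norm of \<open>v\<close> is 0 or 1, and 1 is odd without exceeding
    \<open>m\<close>.\<close>
  ultimately have "form K v v = 0" using assms(1) by presburger
  then have "v = 0"
    using K(1) v(1) unfolding Z_lattice_def by (metis less_irrefl)
  moreover have "?s \<noteq> 0" using 1 \<open>form K v v = 0\<close> by auto
  \<comment> \<open>With \<open>v = 0\<close>, orthogonality of the two images concerns only their
    first components, so the second image lies in \<open>K\<close>.\<close>
  ultimately have "?t = 0" using 2 Z_lattice_form_zero[OF K(1) v(2)] by simp
  then have "form K v' v' = m" using 3 by simp
  then show False using K(2) v(2) assms(2) by (auto simp: even_upto_def)
qed

section \<open>Congruences on the coordinates of a proper sublattice\<close>

text \<open>A nonempty \<open>I\<close> is a subgroup of \<open>int\<close>, generated by 0 or by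
  its least positive element. This generator is not a unit because \<open>1 \<notin> I\<close>,
  hence it has a prime divisor.\<close>

lemma prime_dvd_proper_int_subgroup:
  fixes I :: "int set"
  assumes diff: "\<And>x y. x \<in> I \<Longrightarrow> y \<in> I \<Longrightarrow> x - y \<in> I"
    and scale: "\<And>k x. x \<in> I \<Longrightarrow> k * x \<in> I" and "1 \<notin> I"
  obtains p :: int where "prime p" "\<forall>x\<in>I. p dvd x"
proof -
  have "\<exists>d. \<bar>d\<bar> \<noteq> 1 \<and> (\<forall>x\<in>I. d dvd x)"
  proof (cases "I \<subseteq> {0}")
    case False
    then obtain x where "x \<in> I" "x \<noteq> 0" by auto
    have "sgn x * x = int (nat \<bar>x\<bar>)" by (simp add: sgn_if)
    then have "int (nat \<bar>x\<bar>) \<in> I" using scale[OF \<open>x \<in> I\<close>, of "sgn x"] by simp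
    then have ex: "\<exists>n. int n \<in> I \<and> n > 0"
      using \<open>x \<noteq> 0\<close> by (intro exI[of _ "nat \<bar>x\<bar>"]) simp
    define n where "n = (LEAST n. int n \<in> I \<and> n > 0)"
    have n: "int n \<in> I" "n > 0"
      using LeastI_ex[OF ex] by (simp_all add: n_def)
    have least: "\<not> (int k \<in> I \<and> k > 0)" if "k < n" for k
      using not_less_Least that unfolding n_def by blast
    have "int n dvd y" if "y \<in> I" for y
    proof -
      have "y mod int n = y - y div int n * int n" by (rule minus_div_mult_eq_mod[symmetric])
      then have "y mod int n \<in> I" using diff[OF that scale[OF n(1)]] by metis
      moreover have "y mod int n \<ge> 0" using n(2) by simp
      ultimately obtain k where k: "y mod int n = int k" "int k \<in> I"
        by (metis nonneg_int_cases)
      have "int k < int n" using n(2) unfolding k(1)[symmetric] by simp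
      then have "\<not> k > 0" using least[of k] k(2) by simp
      then show ?thesis using k(1) by (simp add: dvd_eq_mod_eq_0)
    qed
    moreover have "n \<noteq> 1" using n(1) assms(3) by auto
    ultimately show ?thesis by (intro exI[of _ "int n"]) auto
  next
    case True
    then show ?thesis by (intro exI[of _ 0]) auto
  qed
  then obtain d where d: "\<bar>d\<bar> \<noteq> 1" "\<forall>x\<in>I. d dvd x" by blast
  obtain p :: int where "prime p" "p dvd d" using prime_factor_int[OF d(1)] by blast
  then show thesis using that d(2) dvd_trans by blast
qed

text \<open>\<open>I\<close> is the projection of \<open>M\<close> to the second coordinate. If it
  contains 1, then \<open>M\<close> contains some \<open>w = (s, 1)\<close> and is determined by
  \<open>w\<close> and the subgroup \<open>J\<close> of all \<open>x\<close> with
  \<open>(x, 0)\<close> in \<open>M\<close>; \<open>J\<close> is proper since \<open>M\<close> is. A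
  prime dividing \<open>I\<close> or \<open>J\<close> gives one of the two cases.\<close>

lemma proper_sublattice_congruence:
  assumes "proper_sublattice M (diag_zlat [b, c])"
  obtains p :: int where "prime p" "\<forall>z\<in>carr M. p dvd Poly_Mapping.lookup z 1"
  | p s :: int where "prime p"
      "\<forall>z\<in>carr M. p dvd Poly_Mapping.lookup z 0 - s * Poly_Mapping.lookup z 1"
proof -
  let ?l = "diag_zlat [b, c]"
  have sub: "zmod.subspace (carr M)"
    using assms Z_lattice_subspace by (auto simp: proper_sublattice_def sublattice_def)
  have M: "carr M \<subseteq> carr ?l" "carr M \<noteq> carr ?l"
    using assms by (auto simp: proper_sublattice_def sublattice_def)
  note closed = zmod.subspace_diff[OF sub] zmod.subspace_scale[OF sub] zmod.subspace_add[OF sub]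
  define I where "I = (\<lambda>z. Poly_Mapping.lookup z 1) ` carr M"
  show thesis
  proof (cases "1 \<in> I")
    case False
    have "x - y \<in> I" if xy: "x \<in> I" "y \<in> I" for x y
    proof -
      from xy obtain z z' where "z \<in> carr M" "z' \<in> carr M"
        "x = Poly_Mapping.lookup z 1" "y = Poly_Mapping.lookup z' 1"
        unfolding I_def by blast
      then show ?thesis
        unfolding I_def using closed(1) by (intro image_eqI[of _ _ "z - z'"]) (simp_all add: lookup_minus)
    qed
    moreover have "k * x \<in> I" if x: "x \<in> I" for k x
    proof -
      from x obtain z where "z \<in> carr M" "x = Poly_Mapping.lookup z 1"
        unfolding I_def by blast
      then show ?thesis
        unfolding I_def using closed(2) by (intro image_eqI[of _ _ "zscale k z"]) simp_all
    qed
    ultimately obtain p where "prime p" "\<forall>x\<in>I. p dvd x"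
      using prime_dvd_proper_int_subgroup[of I] False by metis
    then show thesis unfolding I_def by (intro that(1)[of p]) simp_all
  next
    case True
    then obtain w where w: "w \<in> carr M" "Poly_Mapping.lookup w 1 = 1" by (auto simp: I_def)
    define s where "s = Poly_Mapping.lookup w 0"
    define J where "J = (\<lambda>z. Poly_Mapping.lookup z 0) ` {z \<in> carr M. Poly_Mapping.lookup z 1 = 0}"
    have "1 \<notin> J"
    proof
      assume "1 \<in> J"
      then obtain v where v: "v \<in> carr M" "Poly_Mapping.lookup v 0 = 1" "Poly_Mapping.lookup v 1 = 0"
        by (auto simp: J_def)
      have "z \<in> carr M" if z: "z \<in> carr ?l" for z
      proof -
        let ?y = "Poly_Mapping.lookup z 1"
        let ?z = "zscale (Poly_Mapping.lookup z 0 - ?y * s) v + zscale ?y w"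
        have "?z \<in> carr M" by (intro closed v w)
        moreover from this have "?z \<in> carr ?l" using M(1) by blast
        then have "z = ?z"
          using v(2,3) w(2) by (intro carr_diag_zlat_pair_eqI[OF z]) (simp_all add: lookup_add s_def)
        ultimately show ?thesis by simp
      qed
      then show False using M by blast
    qed
    moreover have "x - y \<in> J" if "x \<in> J" "y \<in> J" for x y
    proof -
      from that obtain z z' where "z \<in> carr M" "z' \<in> carr M" "Poly_Mapping.lookup z 1 = 0"
        "Poly_Mapping.lookup z' 1 = 0" "x = Poly_Mapping.lookup z 0" "y = Poly_Mapping.lookup z' 0"
        by (auto simp: J_def)
      then show ?thesis
        unfolding J_def using closed(1) by (intro image_eqI[of _ _ "z - z'"]) (auto simp: lookup_minus)
    qed
    moreover have "k * x \<in> J" if "x \<in> J" for k x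
    proof -
      from that obtain z where "z \<in> carr M" "Poly_Mapping.lookup z 1 = 0" "x = Poly_Mapping.lookup z 0"
        by (auto simp: J_def)
      then show ?thesis
        unfolding J_def using closed(2) by (intro image_eqI[of _ _ "zscale k z"]) auto
    qed
    ultimately obtain p where p: "prime p" "\<forall>x\<in>J. p dvd x"
      using prime_dvd_proper_int_subgroup[of J] by metis
    have "p dvd Poly_Mapping.lookup z 0 - s * Poly_Mapping.lookup z 1" if "z \<in> carr M" for z
    proof -
      \<comment> \<open>Subtracting a multiple of \<open>w\<close> clears the second coordinate, so
        the first one falls into \<open>J\<close>.\<close>
      let ?z = "z - zscale (Poly_Mapping.lookup z 1) w"
      have "?z \<in> carr M" by (intro closed that w)
      then have "Poly_Mapping.lookup ?z 0 \<in> J"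
        unfolding J_def using w by (intro imageI) (simp add: lookup_minus)
      then have "p dvd Poly_Mapping.lookup ?z 0" using p(2) by blast
      then show ?thesis by (simp add: lookup_minus s_def mult.commute)
    qed
    then show thesis using that(2) p(1) by blast
  qed
qed

section \<open>Splitting a square off the form of a sublattice\<close>

lemma represents_osum_diag:
  assumes "\<forall>x\<in>carr M. s x \<in> carr K"
    and "\<forall>x\<in>carr M. \<forall>y\<in>carr M. a (x + y) = a x + a y \<and> s (x + y) = s x + s y"
    and "\<forall>k. \<forall>x\<in>carr M. a (zscale k x) = k * a x \<and> s (zscale k x) = zscale k (s x)"
    and "\<forall>x\<in>carr M. \<forall>y\<in>carr M. form M x y = a x * a y + form K (s x) (s y)"
  shows "represents (osum (diag_zlat [1]) K) M"
  unfolding represents_def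
proof (intro exI[of _ "\<lambda>x. (Poly_Mapping.single 0 (a x), s x)"] conjI ballI allI)
  fix k x y assume x: "x \<in> carr M"
  show "(Poly_Mapping.single 0 (a x), s x) \<in> carr (osum (diag_zlat [1]) K)"
    using assms(1) x by (simp add: diag_zlat_def)
  show "(Poly_Mapping.single 0 (a (zscale k x)), s (zscale k x)) =
      zscale k (Poly_Mapping.single 0 (a x), s x)"
    using assms(3) x
    by (simp add: zscale_Pair) (auto simp: lookup_single when_def intro!: poly_mapping_eqI)
  assume y: "y \<in> carr M"
  show "(Poly_Mapping.single 0 (a (x + y)), s (x + y)) =
      (Poly_Mapping.single 0 (a x), s x) + (Poly_Mapping.single 0 (a y), s y)"
    using assms(2) x y by (simp add: single_add)
  show "form (osum (diag_zlat [1]) K) (Poly_Mapping.single 0 (a x), s x)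
      (Poly_Mapping.single 0 (a y), s y) = form M x y"
    using assms(4) x y by (simp add: form_diag_zlat_singleton)
qed

text \<open>A vector goes to its coordinate \<open>i\<close> and its coordinate \<open>j\<close>
  divided by \<open>p\<close>; the factor \<open>p\<^sup>2\<close> in the form of \<open>K\<close>
  makes up for the division. The second choice of \<open>(i, j)\<close> exchanges the coordinates,
  which preserves the form because \<open>m = 1\<close>.\<close>

lemma represents_osum_dvd_coordinate:
  fixes m p :: int and i j :: nat
  assumes "m > 0" "p > 1" and M: "sublattice M (diag_zlat [1, m])"
    and ij: "(i, j) = (0, 1) \<or> (i, j) = (1, 0) \<and> m = 1"
    and dvd: "\<forall>z\<in>carr M. p dvd Poly_Mapping.lookup z j"
  shows "\<exists>K :: (nat \<Rightarrow>\<^sub>0 int) zlat. Z_lattice K \<and> even_upto m K \<and>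
    represents (osum (diag_zlat [1]) K) M"
proof (intro exI conjI)
  let ?K = "diag_zlat [p\<^sup>2 * m]"
  show "Z_lattice ?K" using assms(1,2) by (intro Z_lattice_diag_zlat) simp
  show "even_upto m ?K"
    unfolding even_upto_def
  proof
    fix v :: "nat \<Rightarrow>\<^sub>0 int"
    let ?t = "Poly_Mapping.lookup v 0"
    \<comment> \<open>As \<open>p > 1\<close>, nonzero multiples of \<open>p\<close> exceed 1 in
      absolute value, so all nonzero norms of \<open>?K\<close> exceed \<open>m\<close>.\<close>
    have "m < m * (p * ?t)\<^sup>2" if "?t \<noteq> 0"
    proof -
      have "\<bar>p * ?t\<bar> > 1"
        using assms(2) that by (simp add: abs_mult) (smt (verit) mult_le_cancel_left1)
      then have "(p * ?t)\<^sup>2 > 1" by (metis abs_square_le_1 linorder_not_le)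
      then show ?thesis using assms(1) by simp
    qed
    then show "even (form ?K v v) \<or> form ?K v v > m"
      unfolding form_diag_zlat_singleton
      by (cases "?t = 0") (auto simp: power2_eq_square mult_ac)
  qed
  show "represents (osum (diag_zlat [1]) ?K) M"
  proof (rule represents_osum_diag[where a = "\<lambda>z. Poly_Mapping.lookup z i" and
        s = "\<lambda>z. Poly_Mapping.single 0 (Poly_Mapping.lookup z j div p)"])
    show "\<forall>x\<in>carr M. \<forall>y\<in>carr M. form M x y = Poly_Mapping.lookup x i * Poly_Mapping.lookup y i +
      form ?K (Poly_Mapping.single 0 (Poly_Mapping.lookup x j div p))
        (Poly_Mapping.single 0 (Poly_Mapping.lookup y j div p))"
    proof (intro ballI)
      fix x y assume xy: "x \<in> carr M" "y \<in> carr M"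
      then obtain c d where cd: "Poly_Mapping.lookup x j = p * c" "Poly_Mapping.lookup y j = p * d"
        using dvd by (meson dvdE)
      have "form M x y = form (diag_zlat [1, m]) x y" using M xy by (simp add: sublattice_def)
      also have "\<dots> = Poly_Mapping.lookup x i * Poly_Mapping.lookup y i +
          m * Poly_Mapping.lookup x j * Poly_Mapping.lookup y j"
        using ij by (auto simp: form_diag_zlat_pair)
      finally show "form M x y = Poly_Mapping.lookup x i * Poly_Mapping.lookup y i +
        form ?K (Poly_Mapping.single 0 (Poly_Mapping.lookup x j div p))
          (Poly_Mapping.single 0 (Poly_Mapping.lookup y j div p))"
        using assms(2) by (simp add: form_diag_zlat_singleton cd power2_eq_square mult_ac)
    qed
    \<comment> \<open>Division by \<open>p\<close> is linear here since all the dividends are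
      multiples of \<open>p\<close>.\<close>
    show "\<forall>k. \<forall>x\<in>carr M. Poly_Mapping.lookup (zscale k x) i = k * Poly_Mapping.lookup x i \<and>
       Poly_Mapping.single 0 (Poly_Mapping.lookup (zscale k x) j div p) =
       zscale k (Poly_Mapping.single (0::nat) (Poly_Mapping.lookup x j div p))"
      using dvd by (auto simp: lookup_single when_def div_mult_swap intro!: poly_mapping_eqI)
    show "\<forall>x\<in>carr M. \<forall>y\<in>carr M.
       Poly_Mapping.lookup (x + y) i = Poly_Mapping.lookup x i + Poly_Mapping.lookup y i \<and>
       Poly_Mapping.single 0 (Poly_Mapping.lookup (x + y) j div p) =
       Poly_Mapping.single (0::nat) (Poly_Mapping.lookup x j div p) +
       Poly_Mapping.single 0 (Poly_Mapping.lookup y j div p)"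
      using dvd by (auto simp: lookup_add single_add[symmetric])
  qed (simp add: diag_zlat_def)
qed

text \<open>\<open>K\<close> is the module \<open>M\<close> with the form
  \<open>form M x y - a x * a y\<close>. The assumption \<open>pos\<close> makes it positive
  definite, and \<open>even\<close> makes all its norms even, because \<open>a x\<close> and its
  square have the same parity.\<close>

lemma represents_osum_linear_form:
  fixes a :: "(nat \<Rightarrow>\<^sub>0 int) \<Rightarrow> int"
  assumes M: "Z_lattice M"
    and a: "\<forall>x\<in>carr M. \<forall>y\<in>carr M. a (x + y) = a x + a y"
      "\<forall>k. \<forall>x\<in>carr M. a (zscale k x) = k * a x"
    and even: "\<forall>x\<in>carr M. even (form M x x - a x)"
    and pos: "\<forall>x\<in>carr M. x \<noteq> 0 \<longrightarrow> (a x)\<^sup>2 < form M x x"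
  shows "\<exists>K :: (nat \<Rightarrow>\<^sub>0 int) zlat. Z_lattice K \<and> even_upto m K \<and>
    represents (osum (diag_zlat [1]) K) M"
proof (intro exI conjI)
  let ?K = "\<lparr>carr = carr M, form = (\<lambda>x y. form M x y - a x * a y)\<rparr>"
  show "Z_lattice ?K"
    using M a pos
    unfolding Z_lattice_def by (auto simp: algebra_simps power2_eq_square)
  show "even_upto m ?K"
    using even by (simp add: even_upto_def)
  show "represents (osum (diag_zlat [1]) ?K) M"
    by (rule represents_osum_diag[where a = a and s = "\<lambda>x. x"]) (use a in auto)
qed

text \<open>This is Cauchy-Schwarz for \<open>(x, sqrt m * y)\<close> and
  \<open>(1, b / sqrt m)\<close>, multiplied by \<open>m\<close>: the defect is the square
  \<open>(b * x - m * y)\<^sup>2\<close>, and \<open>m + b\<^sup>2 < m * p\<^sup>2\<close> makes the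
  bound strict.\<close>

lemma linear_form_square_less:
  fixes m b p x y :: int
  assumes "m > 0" "m + b\<^sup>2 < m * p\<^sup>2" "x \<noteq> 0 \<or> y \<noteq> 0"
  shows "(x + b * y)\<^sup>2 < p\<^sup>2 * (x\<^sup>2 + m * y\<^sup>2)"
proof -
  have "x\<^sup>2 + m * y\<^sup>2 > 0"
    using assms(1,3) by (cases "y = 0") (auto intro: add_nonneg_pos)
  have "m * (x + b * y)\<^sup>2 = (m + b\<^sup>2) * (x\<^sup>2 + m * y\<^sup>2) - (b * x - m * y)\<^sup>2"
    by (simp add: power2_eq_square algebra_simps)
  also have "\<dots> \<le> (m + b\<^sup>2) * (x\<^sup>2 + m * y\<^sup>2)" by simp
  also have "\<dots> < (m * p\<^sup>2) * (x\<^sup>2 + m * y\<^sup>2)"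
    using assms(2) \<open>x\<^sup>2 + m * y\<^sup>2 > 0\<close> by (rule mult_strict_right_mono)
  finally show ?thesis using assms(1) by (simp add: mult.assoc)
qed

text \<open>Let \<open>r\<close> be the residue of \<open>- s\<close>. Since \<open>p\<close> is
  odd, exactly one of \<open>r\<close> and \<open>r - p\<close> is odd, and that is
  \<open>b\<close>. Parity gives \<open>\<bar>b\<bar> \<le> p - 2\<close> except for
  \<open>b = - p\<close>, which occurs only if \<open>r = 0\<close>, that is, if
  \<open>p dvd s\<close>.\<close>

lemma odd_representative:
  fixes p s :: int
  assumes "odd p" "p > 0"
  obtains b where "odd b" "\<bar>b\<bar> \<le> p" "p dvd b + s" "p dvd s \<or> \<bar>b\<bar> \<le> p - 2"
proof -
  define r where "r = (- s) mod p"
  have r: "0 \<le> r" "r < p" using assms(2) by (auto simp: r_def)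
  have dvd: "p dvd r + s" unfolding r_def by (simp add: dvd_eq_mod_eq_0 mod_simps)
  show thesis
  proof (cases "odd r")
    case True
    then have "r \<noteq> p - 1" using assms(1) by auto
    then show thesis using True r dvd by (intro that[of r]) simp_all
  next
    case False
    have "p dvd (r - p) + s" using dvd by (metis diff_add_eq dvd_diff dvd_refl)
    moreover have "p dvd s" if "r = 0" using dvd that by simp
    moreover have "r > 1" if "r \<noteq> 0" using False r that by presburger
    ultimately show thesis using r False assms(1) that[of "r - p"] by fastforce
  qed
qed

lemma represents_osum_congruence:
  fixes m p s :: int
  assumes "m > 0" "odd m" "prime p"
    and M: "sublattice M (diag_zlat [1, m])"
    and cong: "\<forall>z\<in>carr M. p dvd Poly_Mapping.lookup z 0 - s * Poly_Mapping.lookup z 1"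
    and nt: "m \<noteq> 1 \<or> \<not> p dvd s"
  shows "\<exists>K :: (nat \<Rightarrow>\<^sub>0 int) zlat. Z_lattice K \<and> even_upto m K \<and>
    represents (osum (diag_zlat [1]) K) M"
proof -
  let ?x = "\<lambda>z. Poly_Mapping.lookup z 0" and ?y = "\<lambda>z. Poly_Mapping.lookup z 1"
  have Z: "Z_lattice M" using M by (simp add: sublattice_def)
  have form: "form M z z = (?x z)\<^sup>2 + m * (?y z)\<^sup>2" if "z \<in> carr M" for z
    using M that by (simp add: sublattice_def form_diag_zlat_pair power2_eq_square)
  have nz: "?x z \<noteq> 0 \<or> ?y z \<noteq> 0" if "z \<in> carr M" "z \<noteq> 0" for z
  proof -
    have "form M z z > 0" using Z that unfolding Z_lattice_def by blast
    then show ?thesis by (auto simp: form[OF that(1)])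
  qed
  have par: "even (form M z z) \<longleftrightarrow> even (?x z + ?y z)" if "z \<in> carr M" for z
    using assms(2) by (simp add: form[OF that])
  have m3: "m \<ge> 3" if "m \<noteq> 1" using that assms(1,2) by presburger
  consider "p = 2" "odd s" | "p = 2" "even s" | "odd p"
    using assms(3) prime_odd_int[of p] prime_ge_2_int[of p] by force
  then show ?thesis
  proof cases
    \<comment> \<open>The coordinates agree modulo 2, so the form is even already and
      \<open>a = 0\<close> will do.\<close>
    case 1
    show ?thesis
    proof (rule represents_osum_linear_form[OF Z, where a = "\<lambda>_. 0"])
      show "\<forall>z\<in>carr M. even (form M z z - 0)"
        using cong 1 by (auto simp: par)
      show "\<forall>z\<in>carr M. z \<noteq> 0 \<longrightarrow> 0\<^sup>2 < form M z z"
        using Z unfolding Z_lattice_def by simp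
    qed simp_all
  next
    \<comment> \<open>\<open>?x z\<close> is even, so the norm has the parity of
      \<open>?y z\<close>. This linear form is small enough because \<open>nt\<close> forces
      \<open>m \<noteq> 1\<close>; for \<open>m = 1\<close>, vectors with \<open>?x z = 0\<close>
      would give equality.\<close>
    case 2
    show ?thesis
    proof (rule represents_osum_linear_form[OF Z, where a = ?y])
      show "\<forall>z\<in>carr M. even (form M z z - ?y z)"
        using cong 2 by (auto simp: par)
      have "m \<ge> 3" using m3 nt 2 by auto
      show "\<forall>z\<in>carr M. z \<noteq> 0 \<longrightarrow> (?y z)\<^sup>2 < form M z z"
      proof (intro ballI impI)
        fix z assume z: "z \<in> carr M" "z \<noteq> 0"
        show "(?y z)\<^sup>2 < form M z z"
        proof (cases "?y z = 0")
          case True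
          then show ?thesis using nz[OF z] by (simp add: form[OF z(1)])
        next
          case False
          then have "(?y z)\<^sup>2 < m * (?y z)\<^sup>2" using \<open>m \<ge> 3\<close> by simp
          then show ?thesis by (simp add: form[OF z(1)] add_strict_increasing2)
        qed
      qed
    qed (auto simp: lookup_add)
  next
    case 3
    have p: "p \<ge> 3" using 3 prime_ge_2_int[OF assms(3)] by presburger
    \<comment> \<open>\<open>p dvd b + s\<close> will make \<open>?x z + b * ?y z\<close> divisible
      by \<open>p\<close>, oddness of \<open>b\<close> and \<open>p\<close> gives the parity
      condition, and the size of \<open>b\<close> gives \<open>bound\<close>.\<close>
    obtain b where b: "odd b" "\<bar>b\<bar> \<le> p" "p dvd b + s" "p dvd s \<or> \<bar>b\<bar> \<le> p - 2"
      using odd_representative[OF 3] p by (metis less_le_trans zero_less_numeral)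
    have p9: "p\<^sup>2 \<ge> 9" using power_mono[OF p, of 2] by simp
    \<comment> \<open>For \<open>m = 1\<close> the sharper estimate
      \<open>\<bar>b\<bar> \<le> p - 2\<close> is essential; for \<open>m \<ge> 3\<close> the
      estimate \<open>\<bar>b\<bar> \<le> p\<close> suffices, since \<open>m < 9 * (m - 1)\<close>
      and \<open>9 \<le> p\<^sup>2\<close>.\<close>
    have bound: "m + b\<^sup>2 < m * p\<^sup>2"
    proof (cases "m = 1")
      case True
      then have "\<bar>b\<bar> \<le> p - 2" using nt b(4) by simp
      then have "b\<^sup>2 \<le> (p - 2)\<^sup>2" using power_mono[of "\<bar>b\<bar>" "p - 2" 2] by simp
      also have "\<dots> = p\<^sup>2 - 4 * p + 4" by (simp add: power2_eq_square algebra_simps)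
      finally show ?thesis using True p by simp
    next
      case False
      have "b\<^sup>2 \<le> p\<^sup>2" using power_mono[OF b(2), of 2] by simp
      moreover have "(m - 1) * 9 \<le> (m - 1) * p\<^sup>2"
        using p9 assms(1) by (intro mult_left_mono) auto
      ultimately show ?thesis using m3[OF False] by (simp add: algebra_simps)
    qed
    define a where "a z = (?x z + b * ?y z) div p" for z :: "nat \<Rightarrow>\<^sub>0 int"
    have pa: "p * a z = ?x z + b * ?y z" if "z \<in> carr M" for z
    proof -
      have "?x z + b * ?y z = (?x z - s * ?y z) + (b + s) * ?y z" by (simp add: algebra_simps)
      then have "p dvd ?x z + b * ?y z" using cong that b(3) by (metis dvd_add dvd_mult2)
      then show ?thesis by (simp add: a_def)
    qed
    have sub: "zmod.subspace (carr M)" using Z by (rule Z_lattice_subspace)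
    show ?thesis
    proof (rule represents_osum_linear_form[OF Z, where a = a])
      show "\<forall>x\<in>carr M. \<forall>y\<in>carr M. a (x + y) = a x + a y"
      proof (intro ballI)
        fix x y assume xy: "x \<in> carr M" "y \<in> carr M"
        then have "p * a (x + y) = p * (a x + a y)"
          using zmod.subspace_add[OF sub xy]
          by (simp add: distrib_left pa) (simp add: lookup_add algebra_simps)
        then show "a (x + y) = a x + a y" using p by simp
      qed
      show "\<forall>k. \<forall>x\<in>carr M. a (zscale k x) = k * a x"
      proof (intro allI ballI)
        fix k x assume x: "x \<in> carr M"
        then have "p * a (zscale k x) = k * (p * a x)"
          using zmod.subspace_scale[OF sub x, of k] by (simp add: pa algebra_simps)
        then show "a (zscale k x) = k * a x" using p by simp
      qed
      show "\<forall>z\<in>carr M. even (form M z z - a z)"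
      proof
        fix z assume z: "z \<in> carr M"
        have "even (p * a z) \<longleftrightarrow> even (?x z + b * ?y z)" using pa[OF z] by simp
        then show "even (form M z z - a z)" using par[OF z] b(1) 3 by simp
      qed
      show "\<forall>z\<in>carr M. z \<noteq> 0 \<longrightarrow> (a z)\<^sup>2 < form M z z"
      proof (intro ballI impI)
        fix z assume z: "z \<in> carr M" "z \<noteq> 0"
        have "p\<^sup>2 * (a z)\<^sup>2 < p\<^sup>2 * form M z z"
          using linear_form_square_less[OF assms(1) bound nz[OF z]]
          unfolding form[OF z(1)] pa[OF z(1), symmetric] power_mult_distrib .
        then show "(a z)\<^sup>2 < form M z z" by (simp add: mult_less_cancel_left)
      qed
    qed
  qed
qed

section \<open>From single sublattices to the theorem\<close>

lemma proper_sublattice_even_upto: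
  fixes m :: int
  assumes "m > 0" "odd m" "proper_sublattice M (diag_zlat [1, m])"
  shows "\<exists>K :: (nat \<Rightarrow>\<^sub>0 int) zlat. Z_lattice K \<and> even_upto m K \<and>
    represents (osum (diag_zlat [1]) K) M"
proof -
  have M: "sublattice M (diag_zlat [1, m])" using assms(3) by (simp add: proper_sublattice_def)
  from assms(3) show ?thesis
  proof (cases rule: proper_sublattice_congruence)
    case (1 p)
    then show ?thesis
      using represents_osum_dvd_coordinate[OF assms(1) prime_gt_1_int M, of p 0 1] by blast
  next
    case (2 p s)
    show ?thesis
    proof (cases "m = 1 \<and> p dvd s")
      case True
      \<comment> \<open>With \<open>p dvd s\<close> the congruence says that \<open>p\<close>
        divides the first coordinate; as \<open>m = 1\<close>, the two coordinates can be
        exchanged.\<close>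
      have "p dvd Poly_Mapping.lookup z 0" if "z \<in> carr M" for z
        using 2(2) that True by (metis dvd_diff_right_iff dvd_mult2 dvd_diff_left_iff)
      then show ?thesis
        using represents_osum_dvd_coordinate[OF assms(1) prime_gt_1_int[OF 2(1)] M, of 1 0] True
        by blast
    next
      case False
      then show ?thesis using represents_osum_congruence[OF assms(1,2) 2(1) M 2(2)] by blast
    qed
  qed
qed

theorem proposition4p2:
  fixes m :: int
  assumes "m > 0" and "odd m"
  shows "\<not> recoverable (diag_zlat [1, m])"
proof
  assume "recoverable (diag_zlat [1, m])"
  then obtain S where S: "finite S" "\<forall>M\<in>S. proper_sublattice M (diag_zlat [1, m])"
    and rec: "\<forall>L :: (nat \<Rightarrow>\<^sub>0 int) zlat. Z_lattice L \<and> (\<forall>M\<in>S. represents L M) \<longrightarrow>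
      represents L (diag_zlat [1, m])"
    by (auto simp: recoverable_def)
  obtain k :: "(nat \<Rightarrow>\<^sub>0 int) zlat \<Rightarrow> (nat \<Rightarrow>\<^sub>0 int) zlat"
    where k: "\<forall>M\<in>S. Z_lattice (k M) \<and> even_upto m (k M) \<and>
      represents (osum (diag_zlat [1]) (k M)) M"
    using S(2) proper_sublattice_even_upto[OF assms] by metis
  obtain K :: "(nat \<Rightarrow>\<^sub>0 int) zlat"
    where K: "Z_lattice K" "even_upto m K" "\<forall>M\<in>S. represents K (k M)"
    using even_upto_common[of "k ` S" m] S(1) k by auto
  have "\<forall>M\<in>S. represents (osum (diag_zlat [1]) K) M"
    using K(3) k represents_osum_mono represents_trans by blast
  moreover have "Z_lattice (osum (diag_zlat [1]) K)"
    using K(1) by (simp add: Z_lattice_osum Z_lattice_diag_zlat)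
  \<comment> \<open>The sum lives on a product type, so \<open>rec\<close> is extended to it by
    \<open>recoverable_universe\<close>.\<close>
  ultimately have "represents (osum (diag_zlat [1]) K) (diag_zlat [1, m])"
    using recoverable_universe[OF rec] by blast
  then show False
    using not_represents_even_upto[OF assms K(1,2)] by blast
qed

end
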